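(* Let $\mathcal{M}'_m$ be a meridian surface of elliptic type in the Minkowski space $\mathbb{R}^4_1$, parameterized by $z(u,v) = f(u)\, l(v) + g(u)\, e_4$, $u\in I$, $v\in J$. The Gauss map $G$ of $\mathcal{M}'_m$ is harmonic (i.e. $\Delta G = 0$) if and only if $\mathcal{M}'_m$ is part of a plane.
   Context: $\mathbb{R}^4_1$ (also written $\mathbb{E}^4_1$) is the four-dimensional Minkowski space with flat metric $\langle\cdot,\cdot\rangle$ of signature $(3,1)$ and fixed orthonormal frame $e_1,e_2,e_3,e_4$, $\langle e_i,e_i\rangle=1$ for $i=1,2,3$, $\langle e_4,e_4\rangle=-1$. Meridian surface of elliptic type: let $f,g:I\to\mathbb{R}$ be smooth functions on an interval $I\subset\mathbb{R}$ with $f(u)>0$ and $(f'(u))^2-(g'(u))^2=1$ for all $u\in I$ (the plane curve $m:u\mapsto(f(u),g(u))$ is called the meridian curve). Let $c: l=l(v)$, $v\in J$ ($J\subset\mathbb{R}$ an interval), be a smooth curve parameterized by arc-length ($\langle l',l'\rangle=1$) on the unit sphere $S^2(1)$ centered at the origin of the Euclidean space $\mathbb{R}^3=\operatorname{span}\{e_1,e_2,e_3\}$. The surface $\mathcal{M}'_m: z(u,v)=f(u)\,l(v)+g(u)\,e_4$, $u\in I,\ v\in J$, is called a meridian surface of elliptic type; it is spacelike with first fundamental form $du^2+f^2(u)\,dv^2$. Gauss map: with $x=z_u$ and $y=z_v/f$ (an orthonormal tangent frame), the Gauss map is $G=x\wedge y$, regarded as a map from the surface into the vector space $\wedge^2\mathbb{R}^4_1$,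 equipped with the indefinite inner product $\langle a_1\wedge a_2, b_1\wedge b_2\rangle=\det(\langle a_k,b_l\rangle)$. Laplacian: $\Delta G=-\nabla'_x\nabla'_xG+\nabla'_{\nabla_xx}G-\nabla'_y\nabla'_yG+\nabla'_{\nabla_yy}G$, where $\nabla'$ is the flat connection of the ambient space (componentwise differentiation) and $\nabla$ is the Levi-Civita connection of the surface. *)

theory Defs
  imports "HOL-Analysis.Analysis"
begin

text \<open>Intervals need not be open, so all derivatives are taken within the interval (one-sided at
  end points). For an interval with nonempty interior these derivatives are unique.\<close>

definition smooth_on_interval :: "real set \<Rightarrow> (real \<Rightarrow> 'a::real_normed_vector) \<Rightarrow> bool" where
  "smooth_on_interval I h \<longleftrightarrow>
     (\<exists>D :: nat \<Rightarrow> real \<Rightarrow> 'a. (\<forall>t\<in>I. D 0 t = h t) \<and>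
        (\<forall>n. \<forall>t\<in>I. (D n has_vector_derivative D (Suc n) t) (at t within I)))"

definition minkowski :: "real^4 \<Rightarrow> real^4 \<Rightarrow> real" where
  "minkowski a b = a$1 * b$1 + a$2 * b$2 + a$3 * b$3 - a$4 * b$4"

text \<open>The exterior square of \<open>real^4\<close> is realised as the space of skew-symmetric matrices;
  entry \<open>(i,j)\<close> with \<open>i < j\<close> is the coordinate with respect to \<open>e\<^sub>i \<and> e\<^sub>j\<close>.\<close>

definition wedge :: "real^4 \<Rightarrow> real^4 \<Rightarrow> real^4^4" where
  "wedge a b = (\<chi> i j. a$i * b$j - a$j * b$i)"

text \<open>Geometry of a surface patch \<open>z\<close> on \<open>I \<times> J\<close>. Tangent vector fields are given
  by their components \<open>X :: real \<Rightarrow> real \<Rightarrow> real^2\<close> with respect to the coordinate fields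
  \<open>z\<^sub>u, z\<^sub>v\<close>; index \<open>1\<close> stands for \<open>u\<close> and index \<open>2\<close> for \<open>v\<close>.\<close>

definition partial_deriv ::
  "real set \<Rightarrow> real set \<Rightarrow> 2 \<Rightarrow> (real \<Rightarrow> real \<Rightarrow> 'a::real_normed_vector) \<Rightarrow> real \<Rightarrow> real \<Rightarrow> 'a" where
  "partial_deriv I J i \<Phi> u v =
     (if i = 1 then vector_derivative (\<lambda>s. \<Phi> s v) (at u within I)
      else vector_derivative (\<lambda>t. \<Phi> u t) (at v within J))"

definition dir_deriv ::
  "real set \<Rightarrow> real set \<Rightarrow> (real \<Rightarrow> real \<Rightarrow> real^2) \<Rightarrow> (real \<Rightarrow> real \<Rightarrow> 'a::real_normed_vector)
     \<Rightarrow> real \<Rightarrow> real \<Rightarrow> 'a" where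
  "dir_deriv I J X \<Phi> u v = (\<Sum>i\<in>UNIV. (X u v $ i) *\<^sub>R partial_deriv I J i \<Phi> u v)"

definition first_fundamental_form ::
  "real set \<Rightarrow> real set \<Rightarrow> (real \<Rightarrow> real \<Rightarrow> real^4) \<Rightarrow> real \<Rightarrow> real \<Rightarrow> real^2^2" where
  "first_fundamental_form I J z u v =
     (\<chi> i j. minkowski (partial_deriv I J i z u v) (partial_deriv I J j z u v))"

text \<open>\<open>christoffel I J z k i j\<close> is the symbol with upper index \<open>k\<close> and lower indices
  \<open>i, j\<close> of the induced metric.\<close>

definition christoffel ::
  "real set \<Rightarrow> real set \<Rightarrow> (real \<Rightarrow> real \<Rightarrow> real^4) \<Rightarrow> 2 \<Rightarrow> 2 \<Rightarrow> 2 \<Rightarrow> real \<Rightarrow> real \<Rightarrow> real" where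
  "christoffel I J z k i j u v =
     (let E = first_fundamental_form I J z in
      (1/2) * (\<Sum>l\<in>UNIV. matrix_inv (E u v) $ k $ l *
        (partial_deriv I J i (\<lambda>s t. E s t $ j $ l) u v
         + partial_deriv I J j (\<lambda>s t. E s t $ i $ l) u v
         - partial_deriv I J l (\<lambda>s t. E s t $ i $ j) u v)))"

definition levi_civita ::
  "real set \<Rightarrow> real set \<Rightarrow> (real \<Rightarrow> real \<Rightarrow> real^4) \<Rightarrow> (real \<Rightarrow> real \<Rightarrow> real^2)
     \<Rightarrow> (real \<Rightarrow> real \<Rightarrow> real^2) \<Rightarrow> real \<Rightarrow> real \<Rightarrow> real^2" where
  "levi_civita I J z X Y u v =
     (\<chi> k. dir_deriv I J X (\<lambda>s t. Y s t $ k) u v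
        + (\<Sum>i\<in>UNIV. \<Sum>j\<in>UNIV. X u v $ i * Y u v $ j * christoffel I J z k i j u v))"

text \<open>For an orthonormal tangent frame \<open>X, Y\<close>. Note that \<open>dir_deriv I J X z\<close> is the
  tangent vector of the ambient space represented by \<open>X\<close>.\<close>

definition gauss_map ::
  "real set \<Rightarrow> real set \<Rightarrow> (real \<Rightarrow> real \<Rightarrow> real^4) \<Rightarrow> (real \<Rightarrow> real \<Rightarrow> real^2)
     \<Rightarrow> (real \<Rightarrow> real \<Rightarrow> real^2) \<Rightarrow> real \<Rightarrow> real \<Rightarrow> real^4^4" where
  "gauss_map I J z X Y u v = wedge (dir_deriv I J X z u v) (dir_deriv I J Y z u v)"

definition surface_laplacian ::
  "real set \<Rightarrow> real set \<Rightarrow> (real \<Rightarrow> real \<Rightarrow> real^4) \<Rightarrow> (real \<Rightarrow> real \<Rightarrow> real^2)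
     \<Rightarrow> (real \<Rightarrow> real \<Rightarrow> real^2) \<Rightarrow> (real \<Rightarrow> real \<Rightarrow> 'a::real_normed_vector) \<Rightarrow> real \<Rightarrow> real \<Rightarrow> 'a" where
  "surface_laplacian I J z X Y \<Phi> u v =
     - dir_deriv I J X (dir_deriv I J X \<Phi>) u v + dir_deriv I J (levi_civita I J z X X) \<Phi> u v
     - dir_deriv I J Y (dir_deriv I J Y \<Phi>) u v + dir_deriv I J (levi_civita I J z Y Y) \<Phi> u v"

definition meridian_surface ::
  "(real \<Rightarrow> real) \<Rightarrow> (real \<Rightarrow> real) \<Rightarrow> (real \<Rightarrow> real^4) \<Rightarrow> real \<Rightarrow> real \<Rightarrow> real^4" where
  "meridian_surface f g l u v = f u *\<^sub>R l v + g u *\<^sub>R axis 4 1"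

text \<open>The frame \<open>x = z\<^sub>u\<close>, \<open>y = z\<^sub>v / f\<close>.\<close>

definition frame_x :: "real \<Rightarrow> real \<Rightarrow> real^2" where
  "frame_x u v = vector [1, 0]"

definition frame_y :: "(real \<Rightarrow> real) \<Rightarrow> real \<Rightarrow> real \<Rightarrow> real^2" where
  "frame_y f u v = vector [0, 1 / f u]"

definition meridian_gauss_map ::
  "real set \<Rightarrow> real set \<Rightarrow> (real \<Rightarrow> real) \<Rightarrow> (real \<Rightarrow> real) \<Rightarrow> (real \<Rightarrow> real^4)
     \<Rightarrow> real \<Rightarrow> real \<Rightarrow> real^4^4" where
  "meridian_gauss_map I J f g l =
     gauss_map I J (meridian_surface f g l) frame_x (frame_y f)"

definition meridian_laplacian ::
  "real set \<Rightarrow> real set \<Rightarrow> (real \<Rightarrow> real) \<Rightarrow> (real \<Rightarrow> real) \<Rightarrow> (real \<Rightarrow> real^4)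
     \<Rightarrow> (real \<Rightarrow> real \<Rightarrow> 'a::real_normed_vector) \<Rightarrow> real \<Rightarrow> real \<Rightarrow> 'a" where
  "meridian_laplacian I J f g l =
     surface_laplacian I J (meridian_surface f g l) frame_x (frame_y f)"

definition part_of_plane :: "(real^4) set \<Rightarrow> bool" where
  "part_of_plane S \<longleftrightarrow> (\<exists>P. affine P \<and> aff_dim P = 2 \<and> S \<subseteq> P)"

end

theory Submission imports Defs begin

text \<open>With \<open>t = l'\<close> the Gauss map is \<open>G = f' l \<and> t + g' e\<^sub>4 \<and> t\<close>, and
  \<open>\<Delta>G = - A l \<and> t - B e\<^sub>4 \<and> t - (f'/f\<^sup>2) (l \<and> t'' + t \<and> t') - (g'/f\<^sup>2) e\<^sub>4 \<and> t''\<close>, where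
  \<open>A = f''' + f'f''/f\<close> and \<open>B = g''' + f'g''/f\<close>. If \<open>\<Delta>G = 0\<close>, evaluating this 2-vector on the
  pairs \<open>(t, t')\<close>, \<open>(l, t)\<close>, \<open>(e\<^sub>4, t)\<close> yields \<open>A = 0\<close>, \<open>\<langle>t', t'\<rangle> = 1\<close> and \<open>B = g'/f\<^sup>2\<close>. The second
  equation forces \<open>t' = -l\<close>, so \<open>l\<close> is an arc of a great circle; combining the other two with the
  derivatives of \<open>f'\<^sup>2 - g'\<^sup>2 = 1\<close> gives \<open>(g'/f)\<^sup>2 = - (g''/f')\<^sup>2\<close>, so \<open>g' = 0\<close>. Planarity is
  equivalent to \<open>t' = -l\<close> and \<open>g' = 0\<close>, and these two conditions make \<open>\<Delta>G\<close> vanish.\<close>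

section \<open>Exterior products, the two inner products, matrix inverses\<close>

lemma bounded_bilinear_wedge: "bounded_bilinear wedge"
proof -
  have "bilinear wedge"
    by (auto simp: bilinear_def wedge_def vec_eq_iff algebra_simps intro!: linearI)
  then show ?thesis
    by (simp add: bilinear_conv_bounded_bilinear)
qed

interpretation wedge: bounded_bilinear wedge
  by (rule bounded_bilinear_wedge)

lemma wedge_self [simp]: "wedge a a = 0"
  by (simp add: wedge_def vec_eq_iff)

lemma wedge_swap: "wedge a b = - wedge b a"
  by (simp add: wedge_def vec_eq_iff)

text \<open>Reads a 2-vector as a skew bilinear form, so that an equation between 2-vectors yields
  scalar equations by evaluation on pairs \<open>(p, q)\<close>.\<close>

lemma inner_wedge_mult_vec:
  "p \<bullet> (wedge a b *v q) = (p \<bullet> a) * (b \<bullet> q) - (p \<bullet> b) * (a \<bullet> q)"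
  unfolding wedge_def inner_vec_def matrix_vector_mult_def sum_4
  by (simp add: algebra_simps)

lemma minkowski_eq_inner: "minkowski a b = a \<bullet> b - 2 * (a $ 4 * b $ 4)"
  by (simp add: minkowski_def inner_vec_def sum_4)

lemma matrix_inv_unique:
  fixes A B :: "'a::field^'n^'n"
  assumes "A ** B = mat 1"
  shows "matrix_inv A = B"
proof -
  have "B ** A = mat 1"
    using assms by (simp add: matrix_left_right_inverse)
  \<comment> \<open>\<open>matrix_inv\<close> is a choice among two-sided inverses; \<open>B\<close>
    shows that one exists.\<close>
  then have "A ** matrix_inv A = mat 1"
    unfolding matrix_inv_def using assms by (rule_tac someI2[of _ B]) auto
  then have "B ** (A ** matrix_inv A) = B"
    by simp
  then show ?thesis
    by (simp add: matrix_mul_assoc \<open>B ** A = mat 1\<close>)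
qed

lemma span_axes_nth_4:
  assumes "x \<in> span {axis 1 1, axis 2 1, axis 3 (1::real)}"
  shows "(x::real^4) $ 4 = 0"
proof -
  have "subspace {x :: real^4. x $ 4 = 0}"
    by (auto simp: subspace_def)
  then have "span {axis 1 1, axis 2 1, axis 3 (1::real)} \<subseteq> {x :: real^4. x $ 4 = 0}"
    by (intro span_minimal) (auto simp: axis_def)
  then show ?thesis
    using assms by auto
qed

section \<open>Derivatives relative to an interval\<close>

text \<open>A connected set with more than one point has no isolated points. This makes derivatives
  within the interval unique.\<close>

lemma interval_within_neq_bot:
  fixes S :: "real set"
  assumes "is_interval S" "interior S \<noteq> {}" "x \<in> S"
  shows "at x within S \<noteq> bot"
proof -
  have "S \<noteq> {y}" for y
    using assms(2) by auto
  then have "x islimpt S"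
    using assms by (intro connected_imp_perfect) (auto simp: is_interval_connected)
  then show ?thesis
    by (simp add: trivial_limit_within)
qed

text \<open>The device for differentiating identities: \<open>d\<close> is the expression given by
  the product rule, and uniqueness of the derivative makes it vanish.\<close>

lemma derivative_of_constant_within:
  fixes h :: "real \<Rightarrow> 'a::real_normed_vector"
  assumes "at u within S \<noteq> bot" "u \<in> S" "\<And>s. s \<in> S \<Longrightarrow> h s = c"
    and "(h has_vector_derivative d) (at u within S)"
  shows "d = 0"
proof -
  have "(h has_vector_derivative 0) (at u within S)"
    by (rule has_vector_derivative_transform[where f="\<lambda>_. c"]) (use assms in auto)
  then show ?thesis
    using assms vector_derivative_unique_within by blast
qed

text \<open>Pairing with any \<open>y\<close> orthogonal to \<open>W\<close> is constant along
  \<open>h\<close>, so \<open>y\<close> is orthogonal to \<open>d\<close>; the double orthogonal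
  complement of \<open>W\<close> is \<open>W\<close> again.\<close>

lemma derivative_in_subspace:
  fixes h :: "real \<Rightarrow> 'a::euclidean_space"
  assumes W: "subspace W" and nb: "at u within S \<noteq> bot" and u: "u \<in> S"
    and h: "\<And>s. s \<in> S \<Longrightarrow> h s - p \<in> W"
    and d: "(h has_vector_derivative d) (at u within S)"
  shows "d \<in> W"
proof -
  have "d \<in> (W\<^sup>\<bottom>)\<^sup>\<bottom>"
    unfolding orthogonal_comp_def[of "W\<^sup>\<bottom>"]
  proof (clarify)
    fix y assume y: "y \<in> W\<^sup>\<bottom>"
    have "y \<bullet> d = 0"
    proof (rule derivative_of_constant_within[OF nb u])
      show "y \<bullet> h s = y \<bullet> p" if "s \<in> S" for s
        using y h[OF that]
        by (auto simp: orthogonal_comp_def orthogonal_def inner_diff_left inner_commute[of y])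
      show "((\<lambda>s. y \<bullet> h s) has_vector_derivative y \<bullet> d) (at u within S)"
        by (rule bounded_linear.has_vector_derivative[OF bounded_linear_inner_right d])
    qed
    then show "orthogonal y d"
      by (simp add: orthogonal_def)
  qed
  then show ?thesis
    by (simp add: orthogonal_comp_self[OF W])
qed

section \<open>The meridian setting and the spherical curve\<close>

text \<open>Derivatives are named functions, which avoids \<open>vector_derivative\<close> in
  computations. Third order is reached because the Gauss map uses first derivatives and the
  Laplacian adds two. Here \<open>t\<close>, \<open>t1\<close>, \<open>t2\<close> are the successive
  derivatives of \<open>l\<close>.\<close>

locale meridian =
  fixes I J :: "real set" and f f1 f2 f3 g g1 g2 g3 :: "real \<Rightarrow> real"
    and l t t1 t2 :: "real \<Rightarrow> real^4"
  assumes limI: "u \<in> I \<Longrightarrow> at u within I \<noteq> bot"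
    and limJ: "v \<in> J \<Longrightarrow> at v within J \<noteq> bot"
    and f: "u \<in> I \<Longrightarrow> (f has_real_derivative f1 u) (at u within I)"
    and f1: "u \<in> I \<Longrightarrow> (f1 has_real_derivative f2 u) (at u within I)"
    and f2: "u \<in> I \<Longrightarrow> (f2 has_real_derivative f3 u) (at u within I)"
    and g: "u \<in> I \<Longrightarrow> (g has_real_derivative g1 u) (at u within I)"
    and g1: "u \<in> I \<Longrightarrow> (g1 has_real_derivative g2 u) (at u within I)"
    and g2: "u \<in> I \<Longrightarrow> (g2 has_real_derivative g3 u) (at u within I)"
    and l: "v \<in> J \<Longrightarrow> (l has_vector_derivative t v) (at v within J)"
    and t: "v \<in> J \<Longrightarrow> (t has_vector_derivative t1 v) (at v within J)"
    and t1: "v \<in> J \<Longrightarrow> (t1 has_vector_derivative t2 v) (at v within J)"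
    and f_pos: "u \<in> I \<Longrightarrow> f u > 0"
    and unit_speed: "u \<in> I \<Longrightarrow> (f1 u)\<^sup>2 - (g1 u)\<^sup>2 = 1"
    and l_nth_4: "v \<in> J \<Longrightarrow> l v $ 4 = 0"
    and l_unit': "v \<in> J \<Longrightarrow> minkowski (l v) (l v) = 1"
    and t_unit': "v \<in> J \<Longrightarrow> minkowski (t v) (t v) = 1"
begin

abbreviation e4 :: "real^4" where "e4 \<equiv> axis 4 1"

lemma nth_4_derivative:
  assumes "v \<in> J" "\<And>s. s \<in> J \<Longrightarrow> h s $ 4 = (0::real)"
    "(h has_vector_derivative d) (at v within J)"
  shows "d $ 4 = 0"
  by (rule derivative_of_constant_within[OF limJ[OF assms(1)] assms(1), where h="\<lambda>s. h s $ 4"])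
    (use assms in \<open>auto intro: bounded_linear.has_vector_derivative[OF bounded_linear_vec_nth]\<close>)

lemma t_nth_4: "v \<in> J \<Longrightarrow> t v $ 4 = 0"
  by (rule nth_4_derivative[OF _ l_nth_4 l])

lemma t1_nth_4: "v \<in> J \<Longrightarrow> t1 v $ 4 = 0"
  by (rule nth_4_derivative[OF _ t_nth_4 t])

lemma t2_nth_4: "v \<in> J \<Longrightarrow> t2 v $ 4 = 0"
  by (rule nth_4_derivative[OF _ t1_nth_4 t1])

lemmas nth_4 = l_nth_4 t_nth_4 t1_nth_4 t2_nth_4

lemma l_l: "v \<in> J \<Longrightarrow> l v \<bullet> l v = 1"
  using l_unit'[of v] by (simp add: minkowski_eq_inner nth_4)

lemma t_t: "v \<in> J \<Longrightarrow> t v \<bullet> t v = 1"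
  using t_unit'[of v] by (simp add: minkowski_eq_inner nth_4)

text \<open>Repeated differentiation of the unit-length identities gives all the frame relations
  below.\<close>

lemma inner_derivative:
  assumes "v \<in> J" "\<And>s. s \<in> J \<Longrightarrow> h s \<bullet> k s = (c::real)"
    "(h has_vector_derivative h') (at v within J)" "(k has_vector_derivative k') (at v within J)"
  shows "h v \<bullet> k' + h' \<bullet> k v = 0"
  by (rule derivative_of_constant_within[OF limJ[OF assms(1)] assms(1), where h="\<lambda>s. h s \<bullet> k s"])
    (use assms in \<open>auto intro: bounded_bilinear.has_vector_derivative[OF bounded_bilinear_inner]\<close>)

lemma l_t: "v \<in> J \<Longrightarrow> l v \<bullet> t v = 0"
  using inner_derivative[OF _ l_l l l] by (simp add: inner_commute)

lemma l_t1: "v \<in> J \<Longrightarrow> l v \<bullet> t1 v = -1"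
  using inner_derivative[OF _ l_t l t] t_t by fastforce

lemma t_t1: "v \<in> J \<Longrightarrow> t v \<bullet> t1 v = 0"
  using inner_derivative[OF _ t_t t t] by (simp add: inner_commute)

lemma t_t2: "v \<in> J \<Longrightarrow> t v \<bullet> t2 v = - (t1 v \<bullet> t1 v)"
  using inner_derivative[OF _ t_t1 t t1] by fastforce

lemma l_t2: "v \<in> J \<Longrightarrow> l v \<bullet> t2 v = 0"
  using inner_derivative[OF _ l_t1 l t1] t_t1 by fastforce

lemma e4_inner: "v \<in> J \<Longrightarrow> l v \<bullet> e4 = 0" "v \<in> J \<Longrightarrow> t v \<bullet> e4 = 0"
    "v \<in> J \<Longrightarrow> t1 v \<bullet> e4 = 0" "v \<in> J \<Longrightarrow> t2 v \<bullet> e4 = 0"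
  by (simp_all add: inner_axis nth_4)

text \<open>Both argument orders are listed for rewriting; \<open>t1 v \<bullet> t1 v\<close>
  remains as an unknown.\<close>

lemmas frame_inner = l_l t_t l_t l_t1 t_t1 t_t2 l_t2 e4_inner
  l_t[unfolded inner_commute[of "l _"]] l_t1[unfolded inner_commute[of "l _"]]
  t_t1[unfolded inner_commute[of "t _"]] t_t2[unfolded inner_commute[of "t _"]]
  l_t2[unfolded inner_commute[of "l _"]] e4_inner[unfolded inner_commute[of _ e4]]

section \<open>Partial derivatives, metric and connection\<close>

text \<open>Agreement with \<open>h\<close> is asked on \<open>I\<close> only, so a closed form of
  an inner derivative, known just on the domain, can be differentiated again.\<close>

lemma partial_deriv_1:
  assumes "u \<in> I" "\<And>s. s \<in> I \<Longrightarrow> \<Phi> s v = h s" "(h has_vector_derivative d) (at u within I)"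
  shows "partial_deriv I J 1 \<Phi> u v = d"
  unfolding partial_deriv_def
  using vector_derivative_within[OF limI[OF assms(1)]
      has_vector_derivative_transform[OF assms(1) assms(2,3)]] by simp

lemma partial_deriv_2:
  assumes "v \<in> J" "\<And>s. s \<in> J \<Longrightarrow> \<Phi> u s = h s" "(h has_vector_derivative d) (at v within J)"
  shows "partial_deriv I J 2 \<Phi> u v = d"
  unfolding partial_deriv_def
  using vector_derivative_within[OF limJ[OF assms(1)]
      has_vector_derivative_transform[OF assms(1) assms(2,3)]] by simp

lemma dir_deriv_frame_x: "dir_deriv I J frame_x \<Phi> u v = partial_deriv I J 1 \<Phi> u v"
  by (simp add: dir_deriv_def sum_2 frame_x_def)

lemma dir_deriv_frame_y:
  "dir_deriv I J (frame_y f) \<Phi> u v = (1 / f u) *\<^sub>R partial_deriv I J 2 \<Phi> u v"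
  by (simp add: dir_deriv_def sum_2 frame_y_def)

abbreviation Z :: "real \<Rightarrow> real \<Rightarrow> real^4" where "Z \<equiv> meridian_surface f g l"

lemma Z_u:
  assumes "u \<in> I"
  shows "partial_deriv I J 1 Z u v = f1 u *\<^sub>R l v + g1 u *\<^sub>R e4"
  by (rule partial_deriv_1[OF assms, OF meridian_surface_def])
    (auto intro!: derivative_eq_intros f g assms)

lemma Z_v:
  assumes "v \<in> J"
  shows "partial_deriv I J 2 Z u v = f u *\<^sub>R t v"
  by (rule partial_deriv_2[OF assms, OF meridian_surface_def])
    (auto intro!: derivative_eq_intros l assms)

abbreviation E :: "real \<Rightarrow> real \<Rightarrow> real^2^2" where "E \<equiv> first_fundamental_form I J Z"

lemma E_eq:
  assumes "u \<in> I" "v \<in> J"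
  shows "E u v = vector [vector [1, 0], vector [0, (f u)\<^sup>2]]"
  using assms unit_speed[of u]
  by (simp add: first_fundamental_form_def vec_eq_iff forall_2 Z_u Z_v minkowski_eq_inner
      inner_add_left inner_add_right frame_inner nth_4 power2_eq_square inner_axis_axis)

lemma E_inv:
  assumes "u \<in> I" "v \<in> J"
  shows "matrix_inv (E u v) = vector [vector [1, 0], vector [0, 1 / (f u)\<^sup>2]]"
  using f_pos[OF assms(1)]
  by (intro matrix_inv_unique)
    (simp add: E_eq[OF assms] matrix_matrix_mult_def mat_def vec_eq_iff forall_2 sum_2)

lemma E_u:
  assumes "u \<in> I" "v \<in> J"
  shows "partial_deriv I J 1 (\<lambda>s r. E s r $ i $ j) u v
    = (if i = 2 \<and> j = 2 then 2 * f u * f1 u else 0)"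
proof (rule partial_deriv_1[OF assms(1)])
  show "E s v $ i $ j = (if i = 2 \<and> j = 2 then (f s)\<^sup>2 else if i = j then 1 else 0)" if "s \<in> I" for s
    using exhaust_2[of i] exhaust_2[of j] by (auto simp: E_eq[OF that assms(2)])
  show "((\<lambda>s. if i = 2 \<and> j = 2 then (f s)\<^sup>2 else if i = j then 1 else 0) has_vector_derivative
      (if i = 2 \<and> j = 2 then 2 * f u * f1 u else 0)) (at u within I)"
    by (auto simp flip: has_real_derivative_iff_has_vector_derivative
        intro!: derivative_eq_intros f assms)
qed

lemma E_v:
  assumes "u \<in> I" "v \<in> J"
  shows "partial_deriv I J 2 (\<lambda>s r. E s r $ i $ j) u v = 0"
  by (rule partial_deriv_2[OF assms(2), where h="\<lambda>_. E u v $ i $ j"])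
    (auto simp: E_eq assms)

lemma levi_civita_x_x:
  assumes "u \<in> I" "v \<in> J"
  shows "levi_civita I J Z frame_x frame_x u v = 0"
proof -
  have "dir_deriv I J frame_x (\<lambda>s r. frame_x s r $ k) u v = 0" for k
    unfolding dir_deriv_frame_x
    by (rule partial_deriv_1[OF assms(1)]) (auto simp: frame_x_def)
  then show ?thesis
    by (simp add: levi_civita_def vec_eq_iff sum_2 forall_2 christoffel_def E_inv[OF assms]
        E_u[OF assms] E_v[OF assms] frame_x_def)
qed

text \<open>The only contribution is the Christoffel symbol with upper index \<open>u\<close> and
  lower indices \<open>v, v\<close>, equal to \<open>- f u * f1 u\<close>, divided by
  \<open>(f u)\<^sup>2\<close> from the two factors \<open>1 / f u\<close>.\<close>

lemma levi_civita_y_y: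
  assumes "u \<in> I" "v \<in> J"
  shows "levi_civita I J Z (frame_y f) (frame_y f) u v = vector [- f1 u / f u, 0]"
proof -
  have "dir_deriv I J (frame_y f) (\<lambda>s r. frame_y f s r $ k) u v = 0" for k
    unfolding dir_deriv_frame_y
    using partial_deriv_2[OF assms(2), where h="\<lambda>_. frame_y f u v $ k" and d=0]
    by (simp add: frame_y_def)
  then show ?thesis
    using f_pos[OF assms(1)]
    by (simp add: levi_civita_def vec_eq_iff sum_2 forall_2 christoffel_def E_inv[OF assms]
        E_u[OF assms] E_v[OF assms] frame_y_def power2_eq_square)
qed

section \<open>The Gauss map and its Laplacian\<close>

abbreviation G :: "real \<Rightarrow> real \<Rightarrow> real^4^4" where "G \<equiv> meridian_gauss_map I J f g l"

lemma G_eq: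
  assumes "u \<in> I" "v \<in> J"
  shows "G u v = f1 u *\<^sub>R wedge (l v) (t v) + g1 u *\<^sub>R wedge e4 (t v)"
  using f_pos[OF assms(1)]
  by (simp add: meridian_gauss_map_def gauss_map_def dir_deriv_frame_x dir_deriv_frame_y
      Z_u Z_v assms wedge.add_left wedge.scaleR_left)

lemma G_u:
  assumes "u \<in> I" "v \<in> J"
  shows "partial_deriv I J 1 G u v = f2 u *\<^sub>R wedge (l v) (t v) + g2 u *\<^sub>R wedge e4 (t v)"
  by (rule partial_deriv_1[OF assms(1) G_eq])
    (auto intro!: derivative_eq_intros f1 g1 assms)

lemma G_uu:
  assumes "u \<in> I" "v \<in> J"
  shows "partial_deriv I J 1 (partial_deriv I J 1 G) u v
    = f3 u *\<^sub>R wedge (l v) (t v) + g3 u *\<^sub>R wedge e4 (t v)"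
  by (rule partial_deriv_1[OF assms(1) G_u])
    (auto intro!: derivative_eq_intros f2 g2 assms)

text \<open>The product rule also produces \<open>wedge (t v) (t v)\<close>, which vanishes.\<close>

lemma G_v:
  assumes "u \<in> I" "v \<in> J"
  shows "partial_deriv I J 2 G u v = f1 u *\<^sub>R wedge (l v) (t1 v) + g1 u *\<^sub>R wedge e4 (t1 v)"
  by (rule partial_deriv_2[OF assms(2) G_eq])
    (auto intro!: derivative_eq_intros wedge.has_vector_derivative l t assms
      simp: wedge.zero_left)

lemma G_vv:
  assumes "u \<in> I" "v \<in> J"
  shows "partial_deriv I J 2 (\<lambda>s r. (1 / f s) *\<^sub>R partial_deriv I J 2 G s r) u v
    = (1 / f u) *\<^sub>R (f1 u *\<^sub>R (wedge (l v) (t2 v) + wedge (t v) (t1 v)) + g1 u *\<^sub>R wedge e4 (t2 v))"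
  by (rule partial_deriv_2[OF assms(2), where h="\<lambda>r. (1 / f u) *\<^sub>R
        (f1 u *\<^sub>R wedge (l r) (t1 r) + g1 u *\<^sub>R wedge e4 (t1 r))"])
    (auto intro!: derivative_eq_intros wedge.has_vector_derivative l t t1 assms
      simp: wedge.zero_left G_v[OF assms(1)])

lemma laplacian_gauss_map:
  assumes "u \<in> I" "v \<in> J"
  shows "meridian_laplacian I J f g l G u v =
    - (f3 u + f1 u * f2 u / f u) *\<^sub>R wedge (l v) (t v)
    - (g3 u + f1 u * g2 u / f u) *\<^sub>R wedge e4 (t v)
    - (f1 u / (f u)\<^sup>2) *\<^sub>R (wedge (l v) (t2 v) + wedge (t v) (t1 v))
    - (g1 u / (f u)\<^sup>2) *\<^sub>R wedge e4 (t2 v)"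
proof -
  \<comment> \<open>Equalities of functions are needed, since the first directional derivative is
    itself an argument of the second.\<close>
  have x: "dir_deriv I J frame_x \<Phi> = partial_deriv I J 1 \<Phi>" for \<Phi> :: "real \<Rightarrow> real \<Rightarrow> real^4^4"
    by (intro ext dir_deriv_frame_x)
  have y: "dir_deriv I J (frame_y f) \<Phi> = (\<lambda>s r. (1 / f s) *\<^sub>R partial_deriv I J 2 \<Phi> s r)"
    for \<Phi> :: "real \<Rightarrow> real \<Rightarrow> real^4^4"
    by (intro ext dir_deriv_frame_y)
  have xx: "dir_deriv I J (levi_civita I J Z frame_x frame_x) G u v = 0"
    by (simp add: dir_deriv_def levi_civita_x_x assms)
  have yy: "dir_deriv I J (levi_civita I J Z (frame_y f) (frame_y f)) G u v
      = (- f1 u / f u) *\<^sub>R partial_deriv I J 1 G u v"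
    by (simp add: dir_deriv_def levi_civita_y_y assms sum_2)
  show ?thesis
    unfolding meridian_laplacian_def surface_laplacian_def xx yy
    unfolding x y G_uu[OF assms] G_vv[OF assms] G_u[OF assms]
    by (simp add: algebra_simps power2_eq_square)
qed

section \<open>Harmonicity in terms of the meridian and the spherical curve\<close>

lemma f1_nonzero: "u \<in> I \<Longrightarrow> f1 u \<noteq> 0"
  using unit_speed[of u] by (auto simp: power2_eq_square) (smt (verit) zero_le_square)

lemma f1_f2:
  assumes "u \<in> I"
  shows "f1 u * f2 u = g1 u * g2 u"
proof -
  have "2 * f1 u * f2 u - 2 * g1 u * g2 u = 0"
    by (rule derivative_of_constant_within[OF limI[OF assms] assms unit_speed])
      (auto simp flip: has_real_derivative_iff_has_vector_derivative
        intro!: derivative_eq_intros f1 g1 assms)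
  then show ?thesis by simp
qed

lemma f1_f3:
  assumes "u \<in> I"
  shows "f1 u * f3 u + (f2 u)\<^sup>2 = g1 u * g3 u + (g2 u)\<^sup>2"
proof -
  have "f1 u * f3 u + f2 u * f2 u - (g1 u * g3 u + g2 u * g2 u) = 0"
    by (rule derivative_of_constant_within[OF limI[OF assms] assms,
          where h="\<lambda>u. f1 u * f2 u - g1 u * g2 u" and c=0])
      (auto simp flip: has_real_derivative_iff_has_vector_derivative
        intro!: derivative_eq_intros f1 f2 g1 g2 assms simp: f1_f2)
  then show ?thesis by (simp add: power2_eq_square)
qed

text \<open>The argument is pointwise: a zero of the Laplacian at one point gives both equations
  there.\<close>

lemma harmonic_imp:
  assumes u: "u \<in> I" and v: "v \<in> J" and "meridian_laplacian I J f g l G u v = 0"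
  shows "g1 u = 0" and "t1 v = - l v"
proof -
  have eq: "p \<bullet> (meridian_laplacian I J f g l G u v *v q) = 0" for p q
    using assms(3) by simp
  note expand = laplacian_gauss_map[OF u v] matrix_vector_mult_diff_rdistrib
    matrix_vector_mult_add_rdistrib inner_diff_right inner_add_right
    scaleR_matrix_vector_assoc[symmetric] inner_wedge_mult_vec
  have uminus_mult_vec: "(- A) *v x = - (A *v x)" for A :: "real^4^4" and x
    by (simp add: matrix_vector_mult_def vec_eq_iff sum_negf)
  \<comment> \<open>On \<open>(t v, t1 v)\<close> the curvature terms cancel:
    \<open>wedge (l v) (t2 v)\<close> gives \<open>- (t1 v \<bullet> t1 v)\<close> and
    \<open>wedge (t v) (t1 v)\<close> gives its negative.\<close>
  have A: "f3 u + f1 u * f2 u / f u = 0"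
    using eq[of "t v" "t1 v"]
    by (simp add: expand uminus_mult_vec frame_inner[OF v]
        del: scaleR_minus_left minus_add_distrib)
  have "f1 u / (f u)\<^sup>2 * (1 - t1 v \<bullet> t1 v) = 0"
    using eq[of "l v" "t v"] A
    by (simp add: expand uminus_mult_vec frame_inner[OF v] right_diff_distrib)
  then have q: "t1 v \<bullet> t1 v = 1"
    using f1_nonzero[OF u] f_pos[OF u] by auto
  have B: "g3 u + f1 u * g2 u / f u = g1 u / (f u)\<^sup>2"
    using eq[of e4 "t v"] q
    by (simp add: expand uminus_mult_vec frame_inner[OF v] inner_axis_axis)
  \<comment> \<open>The square expands to \<open>1 - 2 + 1\<close>, as
    \<open>l v \<bullet> t1 v = -1\<close>.\<close>
  have "(t1 v + l v) \<bullet> (t1 v + l v) = 0"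
    by (simp add: inner_add_left inner_add_right q frame_inner[OF v])
  then show "t1 v = - l v"
    by (simp add: eq_neg_iff_add_eq_0)
  \<comment> \<open>This is \<open>f1 u\<close> times \<open>A\<close> minus \<open>g1 u\<close>
    times \<open>B\<close>; the bracket on the right vanishes by \<open>f1_f2\<close>.\<close>
  have "f1 u * f3 u - g1 u * g3 u = - (f1 u / f u) * (f1 u * f2 u - g1 u * g2 u) - (g1 u / f u)\<^sup>2"
    using A B by (simp add: field_simps power2_eq_square) algebra
  then have "(f2 u)\<^sup>2 - (g2 u)\<^sup>2 = (g1 u / f u)\<^sup>2"
    using f1_f2[OF u] f1_f3[OF u] by simp
  \<comment> \<open>Replace \<open>f1 u * f2 u\<close> by \<open>g1 u * g2 u\<close> and use unit
    speed; the sign is opposite to that of the previous equation, so both sides must vanish.\<close>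
  moreover have "(f1 u)\<^sup>2 * ((f2 u)\<^sup>2 - (g2 u)\<^sup>2) = - (g2 u)\<^sup>2"
    using f1_f2[OF u] unit_speed[OF u] by algebra
  ultimately have "(f1 u * (g1 u / f u))\<^sup>2 = - (g2 u)\<^sup>2"
    unfolding power_mult_distrib by simp
  then have "f1 u * (g1 u / f u) = 0"
    by (smt (verit) zero_le_power2 power2_eq_square mult_eq_0_iff)
  then show "g1 u = 0"
    using f1_nonzero[OF u] f_pos[OF u] by auto
qed

text \<open>Differentiating the two conditions along \<open>I\<close> and \<open>J\<close> kills
  \<open>g2\<close>, \<open>g3\<close>, hence \<open>f2\<close>, \<open>f3\<close>, and gives
  \<open>t2 v = - t v\<close>. Then \<open>wedge (l v) (t2 v)\<close> and
  \<open>wedge (t v) (t1 v)\<close> cancel by skew symmetry.\<close>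

lemma laplacian_zero:
  assumes "\<And>u. u \<in> I \<Longrightarrow> g1 u = 0" "\<And>v. v \<in> J \<Longrightarrow> t1 v = - l v" and u: "u \<in> I" and v: "v \<in> J"
  shows "meridian_laplacian I J f g l G u v = 0"
proof -
  have g2_0: "g2 u = 0" if "u \<in> I" for u
    by (rule derivative_of_constant_within[OF limI[OF that] that assms(1)])
      (use g1 that in \<open>auto simp flip: has_real_derivative_iff_has_vector_derivative\<close>)
  have g3: "g3 u = 0"
    by (rule derivative_of_constant_within[OF limI[OF u] u g2_0])
      (use g2[OF u] in \<open>auto simp flip: has_real_derivative_iff_has_vector_derivative\<close>)
  have f2: "f2 u = 0"
    using f1_f2[OF u] f1_nonzero[OF u] assms(1)[OF u] by simp
  have f3: "f3 u = 0"
    using f1_f3[OF u] f1_nonzero[OF u] assms(1)[OF u] f2 g2_0[OF u] by simp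
  have "t2 v = - t v"
    by (rule vector_derivative_unique_within[OF limJ[OF v] t1[OF v]],
        rule has_vector_derivative_transform[OF v assms(2)])
      (auto intro!: derivative_intros l v)
  then show ?thesis
    using wedge_swap[of "t v" "l v"]
    by (simp add: laplacian_gauss_map[OF u v] f2 f3 g3 g2_0[OF u] assms(1)[OF u] assms(2)[OF v]
        wedge.minus_right)
qed

section \<open>Planarity\<close>

text \<open>The direction space of the plane is spanned by \<open>x\<close> and \<open>t\<close>. It contains \<open>t1\<close>, which is
  orthogonal to the unit vector \<open>t\<close>, hence a multiple of \<open>x\<close>; pairing with \<open>e\<^sub>4\<close> and \<open>l\<close> gives the claim.\<close>

lemma planar_imp:
  assumes P: "part_of_plane {Z u v |u v. u \<in> I \<and> v \<in> J}" and u: "u \<in> I" and v: "v \<in> J"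
  shows "g1 u = 0" and "t1 v = - l v"
proof -
  obtain P where P: "affine P" "aff_dim P = 2" and sub: "\<And>u v. u \<in> I \<Longrightarrow> v \<in> J \<Longrightarrow> Z u v \<in> P"
    using P unfolding part_of_plane_def by blast
  define p where "p = Z u v"
  have p: "p \<in> P"
    using sub u v by (simp add: p_def)
  define W where "W = {y. \<exists>x\<in>P. - p + x = y}"
  have W: "subspace W" "affine_parallel P W"
    using parallel_subspace_explicit[OF P(1) p reflexive] unfolding W_def by blast+
  have dimW: "dim W = 2"
    using aff_dim_affine[OF P(1) W] p P(2) by auto
  have in_W: "Z u v - p \<in> W" if "u \<in> I" "v \<in> J" for u v
    using sub[OF that] by (auto simp: W_def)
  define x where "x = f1 u *\<^sub>R l v + g1 u *\<^sub>R e4"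
  have x: "x \<in> W"
  proof (rule derivative_in_subspace[OF W(1) limI[OF u] u in_W])
    show "((\<lambda>s. Z s v) has_vector_derivative x) (at u within I)"
      unfolding meridian_surface_def x_def by (auto intro!: derivative_eq_intros f g u)
  qed (use v in auto)
  have t_W: "t r \<in> W" if "r \<in> J" for r
  proof -
    have "f u *\<^sub>R t r \<in> W"
    proof (rule derivative_in_subspace[OF W(1) limJ[OF that] that in_W])
      show "((\<lambda>s. Z u s) has_vector_derivative f u *\<^sub>R t r) (at r within J)"
        unfolding meridian_surface_def by (auto intro!: derivative_eq_intros l that)
    qed (use u in auto)
    then show ?thesis
      using subspace_scale[OF W(1), of "f u *\<^sub>R t r" "1 / f u"] f_pos[OF u] by simp
  qed
  \<comment> \<open>The curve \<open>t\<close> itself runs in \<open>W\<close>, hence the base point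
    0.\<close>
  have t1_W: "t1 v \<in> W"
    by (rule derivative_in_subspace[OF W(1) limJ[OF v] v _ t[OF v], where p=0]) (simp add: t_W)
  have "x \<bullet> l v = f1 u"
    by (simp add: x_def inner_add_left frame_inner[OF v])
  then have x_nz: "x \<noteq> 0"
    using f1_nonzero[OF u] by auto
  have xt: "x \<bullet> t v = 0"
    by (simp add: x_def inner_add_left frame_inner[OF v])
  have t_nz: "t v \<noteq> 0"
    using t_t[OF v] by auto
  have ne: "x \<noteq> t v"
    using xt x_nz by auto
  have "independent {x, t v}"
    by (rule pairwise_orthogonal_independent)
      (use xt x_nz t_nz in \<open>auto simp: pairwise_def orthogonal_def inner_commute\<close>)
  \<comment> \<open>Two independent vectors of the two-dimensional \<open>W\<close> span it.\<close>
  then have "W \<subseteq> span {x, t v}"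
    using card_ge_dim_independent[of "{x, t v}" W] x t_W[OF v] dimW ne by simp
  then obtain \<alpha> \<beta> where ab: "t1 v = \<alpha> *\<^sub>R x + \<beta> *\<^sub>R t v"
    using t1_W by (auto simp: span_insert span_singleton algebra_simps)
  have "\<beta> = 0"
    using t_t1[OF v] by (simp add: ab inner_add_right inner_commute[of _ x] xt frame_inner[OF v])
  then have t1_eq: "t1 v = \<alpha> *\<^sub>R x"
    using ab by simp
  have \<alpha>: "\<alpha> * f1 u = - 1"
    using l_t1[OF v] \<open>x \<bullet> l v = f1 u\<close> by (simp add: t1_eq inner_commute)
  moreover have "\<alpha> * g1 u = 0"
    using t1_nth_4[OF v] l_nth_4[OF v] by (simp add: t1_eq x_def)
  ultimately show "g1 u = 0" by auto
  then show "t1 v = - l v"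
    using \<alpha> by (simp add: t1_eq x_def)
qed

text \<open>\<open>g\<close> is constant and \<open>l\<close> solves the oscillator equation, so
  \<open>l\<close> stays in a fixed two-dimensional subspace; translating that by the constant
  height gives the plane.\<close>

lemma planar:
  assumes J: "is_interval J" "v0 \<in> J" and I: "is_interval I"
    and g1_0: "\<And>u. u \<in> I \<Longrightarrow> g1 u = 0" and t1_eq: "\<And>v. v \<in> J \<Longrightarrow> t1 v = - l v"
  shows "part_of_plane {Z u v |u v. u \<in> I \<and> v \<in> J}"
proof -
  have "(g has_vector_derivative 0) (at u within I)" if "u \<in> I" for u
    using g[OF that] g1_0[OF that] by (simp add: has_real_derivative_iff_has_vector_derivative)
  then obtain c where c: "\<And>u. u \<in> I \<Longrightarrow> g u = c"
    using has_vector_derivative_zero_constant[of I g] I by (auto simp: is_interval_convex)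
  \<comment> \<open>Rotating the pair \<open>(l v, t v)\<close> back by the angle \<open>v\<close>
    gives constant vectors, the coefficients of \<open>cos\<close> and \<open>sin\<close> in
    \<open>l\<close>.\<close>
  define a where "a v = cos v *\<^sub>R l v - sin v *\<^sub>R t v" for v
  define b where "b v = sin v *\<^sub>R l v + cos v *\<^sub>R t v" for v
  have "(a has_vector_derivative 0) (at v within J)" if "v \<in> J" for v
    unfolding a_def
    by (rule has_vector_derivative_eq_rhs, (rule derivative_intros l t that)+)
      (simp add: t1_eq[OF that])
  then obtain a0 where a0: "\<And>v. v \<in> J \<Longrightarrow> a v = a0"
    using has_vector_derivative_zero_constant[of J a] J(1) by (auto simp: is_interval_convex)
  have "(b has_vector_derivative 0) (at v within J)" if "v \<in> J" for v
    unfolding b_def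
    by (rule has_vector_derivative_eq_rhs, (rule derivative_intros l t that)+)
      (simp add: t1_eq[OF that])
  then obtain b0 where b0: "\<And>v. v \<in> J \<Longrightarrow> b v = b0"
    using has_vector_derivative_zero_constant[of J b] J(1) by (auto simp: is_interval_convex)
  have l_eq: "l v = cos v *\<^sub>R a0 + sin v *\<^sub>R b0" if "v \<in> J" for v
  proof -
    have "cos v *\<^sub>R a v + sin v *\<^sub>R b v = ((cos v)\<^sup>2 + (sin v)\<^sup>2) *\<^sub>R l v"
      unfolding a_def b_def scaleR_add_left by (simp add: algebra_simps power2_eq_square)
    then show ?thesis
      by (simp add: a0 b0 that)
  qed
  \<comment> \<open>Since \<open>a\<close> and \<open>b\<close> are constant, orthonormality at one
    parameter suffices.\<close>
  have "a v0 \<bullet> b v0 = 0" "a v0 \<bullet> a v0 = (cos v0)\<^sup>2 + (sin v0)\<^sup>2"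
    "b v0 \<bullet> b v0 = (sin v0)\<^sup>2 + (cos v0)\<^sup>2"
    by (simp_all add: a_def b_def inner_diff_left inner_diff_right inner_add_left inner_add_right
        frame_inner[OF J(2)] power2_eq_square)
  then have ab: "a0 \<bullet> b0 = 0" "a0 \<bullet> a0 = 1" "b0 \<bullet> b0 = 1"
    by (simp_all add: a0 b0 J)
  then have "a0 \<noteq> b0" "a0 \<noteq> 0" "b0 \<noteq> 0" by auto
  then have "independent {a0, b0}"
    by (intro pairwise_orthogonal_independent)
      (use ab in \<open>auto simp: pairwise_def orthogonal_def inner_commute\<close>)
  then have dim: "dim (span {a0, b0}) = 2"
    using \<open>a0 \<noteq> b0\<close> by (simp add: dim_span dim_eq_card_independent)
  define P where "P = (+) (c *\<^sub>R e4) ` span {a0, b0}"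
  have "affine P"
    unfolding P_def by (simp add: affine_translation[symmetric] subspace_imp_affine)
  moreover have "aff_dim P = 2"
    unfolding P_def using dim by (simp add: aff_dim_translation_eq aff_dim_subspace)
  moreover have "Z u v \<in> P" if "u \<in> I" "v \<in> J" for u v
  proof -
    have "l v \<in> span {a0, b0}"
      unfolding l_eq[OF that(2)] by (intro span_add span_scale span_base) auto
    then have "f u *\<^sub>R l v \<in> span {a0, b0}"
      by (rule span_scale)
    then show ?thesis
      unfolding P_def meridian_surface_def c[OF that(1)] by (auto simp: add.commute)
  qed
  ultimately show ?thesis
    unfolding part_of_plane_def by blast
qed

end

section \<open>From smooth data to the equivalence\<close>

theorem theorem4p1:
  fixes I J :: "real set" and f g :: "real \<Rightarrow> real" and l :: "real \<Rightarrow> real^4"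
  assumes "is_interval I" and "interior I \<noteq> {}"
    and "is_interval J" and "interior J \<noteq> {}"
    and "smooth_on_interval I f" and "smooth_on_interval I g"
    and "\<And>u. u \<in> I \<Longrightarrow> f u > 0"
    and "\<And>u. u \<in> I \<Longrightarrow> (vector_derivative f (at u within I))\<^sup>2
                       - (vector_derivative g (at u within I))\<^sup>2 = 1"
    and "smooth_on_interval J l"
    and "\<And>v. v \<in> J \<Longrightarrow> l v \<in> span {axis 1 1, axis 2 1, axis 3 1}"
    and "\<And>v. v \<in> J \<Longrightarrow> minkowski (l v) (l v) = 1"
    and "\<And>v. v \<in> J \<Longrightarrow> minkowski (vector_derivative l (at v within J))
                                  (vector_derivative l (at v within J)) = 1"
  shows "(\<forall>u\<in>I. \<forall>v\<in>J. meridian_laplacian I J f g l (meridian_gauss_map I J f g l) u v = 0)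
     \<longleftrightarrow> part_of_plane {meridian_surface f g l u v |u v. u \<in> I \<and> v \<in> J}"
proof -
  obtain F where F: "\<And>u. u \<in> I \<Longrightarrow> F 0 u = f u"
    "\<And>n u. u \<in> I \<Longrightarrow> (F n has_vector_derivative F (Suc n) u) (at u within I)"
    using assms(5) unfolding smooth_on_interval_def by blast
  obtain K where K: "\<And>u. u \<in> I \<Longrightarrow> K 0 u = g u"
    "\<And>n u. u \<in> I \<Longrightarrow> (K n has_vector_derivative K (Suc n) u) (at u within I)"
    using assms(6) unfolding smooth_on_interval_def by blast
  obtain L where L: "\<And>v. v \<in> J \<Longrightarrow> L 0 v = l v"
    "\<And>n v. v \<in> J \<Longrightarrow> (L n has_vector_derivative L (Suc n) v) (at v within J)"
    using assms(9) unfolding smooth_on_interval_def by blast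
  have limI: "at u within I \<noteq> bot" if "u \<in> I" for u
    using interval_within_neq_bot assms(1,2) that by blast
  have limJ: "at v within J \<noteq> bot" if "v \<in> J" for v
    using interval_within_neq_bot assms(3,4) that by blast
  have f: "(f has_vector_derivative F 1 u) (at u within I)" if "u \<in> I" for u
    using has_vector_derivative_transform[OF that F(1)[symmetric] F(2)[OF that]] by simp
  have g: "(g has_vector_derivative K 1 u) (at u within I)" if "u \<in> I" for u
    using has_vector_derivative_transform[OF that K(1)[symmetric] K(2)[OF that]] by simp
  have l: "(l has_vector_derivative L 1 v) (at v within J)" if "v \<in> J" for v
    using has_vector_derivative_transform[OF that L(1)[symmetric] L(2)[OF that]] by simp
  interpret meridian I J f "F 1" "F 2" "F 3" g "K 1" "K 2" "K 3" l "L 1" "L 2" "L 3"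
  proof
    fix u assume u: "u \<in> I"
    show "(F 1 u)\<^sup>2 - (K 1 u)\<^sup>2 = 1"
      using assms(8)[OF u] vector_derivative_within[OF limI[OF u] f[OF u]]
        vector_derivative_within[OF limI[OF u] g[OF u]] by simp
  next
    fix v assume v: "v \<in> J"
    show "minkowski (L 1 v) (L 1 v) = 1"
      using assms(12)[OF v] vector_derivative_within[OF limJ[OF v] l[OF v]] by simp
  qed (use limI limJ f g l F(2)[of _ 1] F(2)[of _ 2] K(2)[of _ 1] K(2)[of _ 2]
      L(2)[of _ 1] L(2)[of _ 2] assms(7,10,11) span_axes_nth_4
    in \<open>auto simp: has_real_derivative_iff_has_vector_derivative numeral_2_eq_2 numeral_3_eq_3\<close>)
  \<comment> \<open>\<open>harmonic_imp\<close> and \<open>planar_imp\<close> need a point of both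
    intervals even for a claim about one variable.\<close>
  obtain u0 v0 where "u0 \<in> I" "v0 \<in> J"
    using assms(2,4) interior_subset by blast
  then show ?thesis
    by (intro iffI)
      (blast intro: planar[OF assms(3) _ assms(1)] harmonic_imp laplacian_zero planar_imp)+
qed

end
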